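(* Let $u(x;\vartheta_t)$ (predictor) and $g(x;\psi_0)$ (fixed target) be scalar-output neural networks under NTK parametrization, with parameters drawn independently $\vartheta_0,\psi_0\sim\mathcal N(0,I)$, so that in the infinite-width limit $u(\cdot;\vartheta_0)\sim\mathcal{GP}(0,\kappa^u)$ and $g(\cdot;\psi_0)\sim\mathcal{GP}(0,\kappa^g)$. Let $\mathcal X=\{x_i\}_{i=1}^{N_D}\subset\mathbb R^{d_{\rm in}}$ be a finite training set, let $\Theta$ be the (infinite-width) neural tangent kernel of $u$, and assume $\Theta_{\mathcal X\mathcal X}$ is positive definite. Let $u(x;\vartheta_\infty)=\lim_{t\to\infty}u(x;\vartheta_t)$ be the converged predictor obtained, in the infinite-width limit, by gradient flow on $\mathcal L_{\rm rnd}(\vartheta_t)=\frac12\|u(\mathcal X;\vartheta_t)-g(\mathcal X;\psi_0)\|_2^2$. Then for every finite set of test points $\mathcal X_T$ the post-convergence error $\epsilon(\mathcal X_T;\vartheta_\infty,\psi_0)=u(\mathcal X_T;\vartheta_\infty)-g(\mathcal X_T;\psi_0)$ is Gaussian with mean $\mathbb E[\epsilon(\mathcal X_T;\vartheta_\infty,\psi_0)]=0$ and covariance $$\Sigma^{\epsilon}_{\mathcal X_T\mathcal X_T}(\vartheta_\infty,\psi_0)=\kappa^{\epsilon}_{\mathcal X_T\mathcal X_T}+\Theta_{\mathcal X_T\mathcal X}\Theta_{\mathcal X\mathcal X}^{-1}\kappa^{\epsilon}_{\mathcal X\mathcal X}\Theta_{\mathcal X\mathcal X}^{-1}\Theta_{\mathcal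 X\mathcal X_T}-\bigl(\Theta_{\mathcal X_T\mathcal X}\Theta_{\mathcal X\mathcal X}^{-1}\kappa^{\epsilon}_{\mathcal X\mathcal X_T}+\text{h.c.}\bigr),$$ where $\kappa^{\epsilon}_{xx'}=\kappa^u_{xx'}+\kappa^g_{xx'}$ is the covariance kernel of the initialization error $\epsilon(x;\vartheta_0,\psi_0)=u(x;\vartheta_0)-g(x;\psi_0)$, and h.c. denotes the Hermitian conjugate (transpose) of the preceding term.
   Context: Networks (NTK parametrization). A fully connected network $f(x;\theta)$ with $L$ layers and hidden widths $n_1=\dots=n_{L-1}=n$, input dimension $n_0=d_{\rm in}$, is defined by $z^l_i(x)=\sigma_b b^l_i+\frac{\sigma_w}{\sqrt{n_{l-1}}}\sum_{j=1}^{n_{l-1}}w^l_{ij}x^l_j(x)$, $x^1(x)=x$, $x^l_j(x)=\phi(z^{l-1}_j(x))$ for $l\ge2$, $f(x;\theta)=z^L(x)$ (scalar output), where $\phi:\mathbb R\to\mathbb R$ is a Lipschitz nonlinearity, $\sigma_w,\sigma_b$ are constants and $\theta$ collects all $w^l,b^l$, which are i.i.d. standard normal at initialization. Kernels. NNGP kernel: $\kappa(x,x')=\lim_{n\to\infty}\mathbb E_{\theta_0}[f(x;\theta_0)f(x';\theta_0)]$. Neural tangent kernel (NTK): $\Theta(x,x')=\lim_{n\to\infty}\nabla_\theta f(x;\theta_0)^\top\nabla_\theta f(x';\theta_0)$, a deterministic limit in probability. Infinite-width regime (standing convention, taken from the literature): in the limit $n\to\infty$, (i) the initial function $f(\cdot;\theta_0)$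 is a centered Gaussian process with kernel $\kappa$ (limit in distribution of finite-dimensional marginals); networks with independent parameters have independent limits; (ii) the tangent kernel stays equal to $\Theta$ for all training times, so gradient flow $\frac{d}{dt}\theta_t=-\nabla_\theta\mathcal L(\theta_t)$ on $\mathcal L=\frac12\|f(\mathcal X;\theta_t)-\mathcal Y\|_2^2$ becomes the linear ODE $\frac{d}{dt}f(x;\theta_t)=-\Theta(x,\mathcal X)\,(f(\mathcal X;\theta_t)-\mathcal Y)$, started at $f(\cdot;\theta_0)$. $\theta_\infty$ denotes the limit $t\to\infty$ of these infinite-width dynamics. Notation. For finite point sets $A,B$, $f(A)$ is the vector of values and $k_{AB}=(k(a,b))_{a\in A,b\in B}$ for a kernel $k$. *)

theory Defs
  imports "HOL-Probability.Probability"
begin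

text \<open>
  Inputs live in \<open>real ^ 'd\<close>, so the input dimension is \<open>CARD('d)\<close>.  Layers are numbered
  \<open>1, \<dots>, depth\<close>, neurons are numbered from 0.  The weights of layer 1 have their own
  constructor because they are indexed by input coordinates.
\<close>

record architecture =
  depth :: nat
  activation :: "real \<Rightarrow> real"
  sigma_w :: real
  sigma_b :: real

datatype 'd param = W_in nat 'd | W nat nat nat | B nat nat

definition layer_width :: "architecture \<Rightarrow> nat \<Rightarrow> nat \<Rightarrow> nat" where
  "layer_width a n l = (if l = depth a then 1 else n)"

definition params :: "architecture \<Rightarrow> nat \<Rightarrow> ('d::finite) param set" where
  "params a n =
     {W_in i j | i j. i < layer_width a n 1} \<union>
     {W l i j | l i j. 2 \<le> l \<and> l \<le> depth a \<and> i < layer_width a n l \<and> j < n} \<union>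
     {B l i | l i. 1 \<le> l \<and> l \<le> depth a \<and> i < layer_width a n l}"

text \<open>The first layer argument is shifted: \<open>preact a n \<theta> x l i\<close> is $z^{l+1}_i(x)$.\<close>

fun preact ::
  "architecture \<Rightarrow> nat \<Rightarrow> (('d::finite) param \<Rightarrow> real) \<Rightarrow> real ^ 'd \<Rightarrow> nat \<Rightarrow> nat \<Rightarrow> real" where
  "preact a n \<theta> x 0 i =
     sigma_b a * \<theta> (B 1 i) +
     sigma_w a / sqrt (real CARD('d)) * (\<Sum>j\<in>UNIV. \<theta> (W_in i j) * x $ j)"
| "preact a n \<theta> x (Suc l) i =
     sigma_b a * \<theta> (B (l + 2) i) +
     sigma_w a / sqrt (real n) *
       (\<Sum>j<n. \<theta> (W (l + 2) i j) * activation a (preact a n \<theta> x l j))"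

definition network ::
  "architecture \<Rightarrow> nat \<Rightarrow> (('d::finite) param \<Rightarrow> real) \<Rightarrow> real ^ 'd \<Rightarrow> real" where
  "network a n \<theta> x = preact a n \<theta> x (depth a - 1) 0"

definition valid_architecture :: "architecture \<Rightarrow> bool" where
  "valid_architecture a \<longleftrightarrow> 1 \<le> depth a \<and> (\<exists>C. C-lipschitz_on UNIV (activation a))"

definition init_law :: "architecture \<Rightarrow> nat \<Rightarrow> (('d::finite) param \<Rightarrow> real) measure" where
  "init_law a n = (\<Pi>\<^sub>M p\<in>params a n. std_normal_distribution)"

definition is_nngp_kernel ::
  "architecture \<Rightarrow> (real ^ 'd::finite \<Rightarrow> real ^ 'd \<Rightarrow> real) \<Rightarrow> bool" where
  "is_nngp_kernel a \<kappa> \<longleftrightarrow>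
     (\<forall>x x'. (\<lambda>n. \<integral>\<theta>. network a n \<theta> x * network a n \<theta> x' \<partial>init_law a n) \<longlonglongrightarrow> \<kappa> x x')"

text \<open>
  The inner product of the parameter gradients, written with partial derivatives.  A Lipschitz
  activation may fail to be differentiable at some points; at parameters where a partial
  derivative does not exist, \<open>deriv\<close> has an unspecified value.
\<close>

definition empirical_ntk ::
  "architecture \<Rightarrow> nat \<Rightarrow> (('d::finite) param \<Rightarrow> real) \<Rightarrow> real ^ 'd \<Rightarrow> real ^ 'd \<Rightarrow> real" where
  "empirical_ntk a n \<theta> x x' =
     (\<Sum>p\<in>params a n.
        deriv (\<lambda>s. network a n (\<theta>(p := s)) x) (\<theta> p) *
        deriv (\<lambda>s. network a n (\<theta>(p := s)) x') (\<theta> p))"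

text \<open>
  Convergence in probability of random variables on varying probability spaces to a constant.
  Measurability is part of the notion: \<open>measure\<close> is 0 on non-measurable sets.
\<close>

definition tendsto_in_probability ::
  "(nat \<Rightarrow> 'a measure) \<Rightarrow> (nat \<Rightarrow> 'a \<Rightarrow> real) \<Rightarrow> real \<Rightarrow> bool" where
  "tendsto_in_probability M Z c \<longleftrightarrow>
     (\<forall>n. Z n \<in> borel_measurable (M n)) \<and>
     (\<forall>e>0. (\<lambda>n. measure (M n) {\<omega> \<in> space (M n). e \<le> \<bar>Z n \<omega> - c\<bar>}) \<longlonglongrightarrow> 0)"

definition is_ntk ::
  "architecture \<Rightarrow> (real ^ 'd::finite \<Rightarrow> real ^ 'd \<Rightarrow> real) \<Rightarrow> bool" where
  "is_ntk a \<Theta> \<longleftrightarrow>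
     (\<forall>x x'. tendsto_in_probability (init_law a) (\<lambda>n \<theta>. empirical_ntk a n \<theta> x x') (\<Theta> x x'))"

text \<open>Normal distributions, including the degenerate ones with variance 0.\<close>

definition normal_law :: "real \<Rightarrow> real \<Rightarrow> real measure" where
  "normal_law \<mu> \<sigma> = (if \<sigma> = 0 then return borel \<mu> else density lborel (normal_density \<mu> \<sigma>))"

text \<open>
  Singular covariance matrices must be allowed, so a finite family is jointly Gaussian if all its
  linear combinations are (possibly degenerate) univariate normal.
\<close>

definition jointly_gaussian :: "'w measure \<Rightarrow> 'i set \<Rightarrow> ('i \<Rightarrow> 'w \<Rightarrow> real) \<Rightarrow> bool" where
  "jointly_gaussian M I Z \<longleftrightarrow>
     (\<forall>i\<in>I. Z i \<in> borel_measurable M) \<and>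
     (\<forall>c :: 'i \<Rightarrow> real. \<exists>\<mu> \<sigma>. 0 \<le> \<sigma> \<and>
        distr M borel (\<lambda>\<omega>. \<Sum>i\<in>I. c i * Z i \<omega>) = normal_law \<mu> \<sigma>)"

definition covariance :: "'w measure \<Rightarrow> ('w \<Rightarrow> real) \<Rightarrow> ('w \<Rightarrow> real) \<Rightarrow> real" where
  "covariance M Y Z =
     (\<integral>\<omega>. (Y \<omega> - (\<integral>\<omega>'. Y \<omega>' \<partial>M)) * (Z \<omega> - (\<integral>\<omega>'. Z \<omega>' \<partial>M)) \<partial>M)"

definition covariance_matrix :: "'w measure \<Rightarrow> ('k::finite \<Rightarrow> 'w \<Rightarrow> real) \<Rightarrow> real ^ 'k ^ 'k" where
  "covariance_matrix M Z = (\<chi> i j. covariance M (Z i) (Z j))"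

definition centered_gp :: "'w measure \<Rightarrow> ('x \<Rightarrow> 'w \<Rightarrow> real) \<Rightarrow> ('x \<Rightarrow> 'x \<Rightarrow> real) \<Rightarrow> bool" where
  "centered_gp M U \<kappa> \<longleftrightarrow>
     (\<forall>A. finite A \<longrightarrow> jointly_gaussian M A U) \<and>
     (\<forall>x. (\<integral>\<omega>. U x \<omega> \<partial>M) = 0) \<and>
     (\<forall>x x'. covariance M (U x) (U x') = \<kappa> x x')"

definition independent_processes ::
  "'w measure \<Rightarrow> ('x \<Rightarrow> 'w \<Rightarrow> real) \<Rightarrow> ('x \<Rightarrow> 'w \<Rightarrow> real) \<Rightarrow> bool" where
  "independent_processes M U V \<longleftrightarrow>
     prob_space.indep_var M
       (\<Pi>\<^sub>M x\<in>UNIV. borel) (\<lambda>\<omega> x. U x \<omega>)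
       (\<Pi>\<^sub>M x\<in>UNIV. borel) (\<lambda>\<omega> x. V x \<omega>)"

text \<open>
  Convergence in distribution of the finite-dimensional marginals of the network at
  initialization.  Bounded continuous functions of the values on a finite set \<open>A\<close> are represented
  by bounded continuous functions \<open>h\<close> on the product space of all functions, applied to
  restrictions to \<open>A\<close> (which are constant outside \<open>A\<close>).
\<close>

definition fdd_limit ::
  "architecture \<Rightarrow> 'w measure \<Rightarrow> (real ^ 'd::finite \<Rightarrow> 'w \<Rightarrow> real) \<Rightarrow> bool" where
  "fdd_limit a M U \<longleftrightarrow>
     (\<forall>A (h :: (real ^ 'd \<Rightarrow> real) \<Rightarrow> real).
        finite A \<longrightarrow> continuous_on UNIV h \<longrightarrow> bounded (range h) \<longrightarrow>
        (\<lambda>n. \<integral>\<theta>. h (\<lambda>x\<in>A. network a n \<theta> x) \<partial>init_law a n)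
          \<longlonglongrightarrow> (\<integral>\<omega>. h (\<lambda>x\<in>A. U x \<omega>) \<partial>M))"

text \<open>
  \<open>U\<close> is the random initial function of an infinitely wide network: the limit in distribution of
  the finite networks, which is a centered Gaussian process whose kernel is the NNGP kernel.
\<close>

definition infinite_width_init ::
  "architecture \<Rightarrow> 'w measure \<Rightarrow> (real ^ 'd::finite \<Rightarrow> real ^ 'd \<Rightarrow> real) \<Rightarrow>
     (real ^ 'd \<Rightarrow> 'w \<Rightarrow> real) \<Rightarrow> bool" where
  "infinite_width_init a M \<kappa> U \<longleftrightarrow>
     is_nngp_kernel a \<kappa> \<and> fdd_limit a M U \<and> centered_gp M U \<kappa>"

text \<open>
  Gradient flow in the infinite-width limit on $\frac12 \sum_j (f(X_j) - y_j)^2$: the tangent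
  kernel is frozen at \<open>\<Theta>\<close>, so the flow is a linear ODE in function space.
\<close>

definition infinite_width_flow ::
  "('x \<Rightarrow> 'x \<Rightarrow> real) \<Rightarrow> ('m::finite \<Rightarrow> 'x) \<Rightarrow> ('m \<Rightarrow> real) \<Rightarrow> (real \<Rightarrow> 'x \<Rightarrow> real) \<Rightarrow> bool" where
  "infinite_width_flow \<Theta> X y f \<longleftrightarrow>
     (\<forall>t\<ge>0. \<forall>x. ((\<lambda>s. f s x) has_real_derivative
        - (\<Sum>j\<in>UNIV. \<Theta> x (X j) * (f t (X j) - y j))) (at t within {0..}))"

definition converged :: "(real \<Rightarrow> 'x \<Rightarrow> 'w \<Rightarrow> real) \<Rightarrow> 'x \<Rightarrow> 'w \<Rightarrow> real" where
  "converged u x \<omega> = Lim at_top (\<lambda>t. u t x \<omega>)"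

definition post_convergence_error ::
  "(real \<Rightarrow> 'x \<Rightarrow> 'w \<Rightarrow> real) \<Rightarrow> ('x \<Rightarrow> 'w \<Rightarrow> real) \<Rightarrow> 'x \<Rightarrow> 'w \<Rightarrow> real" where
  "post_convergence_error u g x \<omega> = converged u x \<omega> - g x \<omega>"

definition error_kernel :: "('x \<Rightarrow> 'x \<Rightarrow> real) \<Rightarrow> ('x \<Rightarrow> 'x \<Rightarrow> real) \<Rightarrow> 'x \<Rightarrow> 'x \<Rightarrow> real" where
  "error_kernel \<kappa>u \<kappa>g x x' = \<kappa>u x x' + \<kappa>g x x'"

definition kernel_matrix ::
  "('x \<Rightarrow> 'x \<Rightarrow> real) \<Rightarrow> ('k \<Rightarrow> 'x) \<Rightarrow> ('m \<Rightarrow> 'x) \<Rightarrow> real ^ 'm::finite ^ 'k::finite" where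
  "kernel_matrix k P Q = (\<chi> i j. k (P i) (Q j))"

definition positive_definite :: "real ^ 'm ^ 'm::finite \<Rightarrow> bool" where
  "positive_definite A \<longleftrightarrow> transpose A = A \<and> (\<forall>v. v \<noteq> 0 \<longrightarrow> 0 < v \<bullet> (A *v v))"

end

theory Submission
  imports Defs
begin

text \<open>
  The frozen-kernel flow contracts the training residual exponentially and conserves
  $f_t(x) - \Theta_{xX} \Theta_{XX}^{-1} (f_t(X) - y)$.  Letting $t \to \infty$, the error after convergence is
  $\epsilon_0(x) - \Theta_{xX} \Theta_{XX}^{-1} \epsilon_0(X)$, a fixed linear image of the
  initialization error $\epsilon_0 = u_0 - g$.  The latter is a centered Gaussian process with
  kernel $\kappa^u + \kappa^g$ by independence, so Gaussianity is inherited and the covariance is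
  obtained by expanding the product.  The tangent kernel is symmetric because it is a limit in
  probability of symmetric kernels and such limits are unique.
\<close>

subsection \<open>Gradient flow with a frozen kernel\<close>

text \<open>The quadratic form is continuous, so it attains its minimum on the compact unit sphere;
  that minimum is positive, and homogeneity of degree two extends the bound to all vectors. The
  constant becomes the decay rate of the flow.\<close>

lemma positive_definite_coercive:
  fixes A :: "real ^ 'm ^ 'm::finite"
  assumes "positive_definite A"
  obtains \<beta> where "0 < \<beta>" "\<And>v. \<beta> * (norm v)\<^sup>2 \<le> v \<bullet> (A *v v)"
proof -
  let ?q = "\<lambda>v :: real ^ 'm. v \<bullet> (A *v v)"
  have "continuous_on (sphere 0 1) ?q"
    by (intro continuous_intros linear_continuous_on matrix_vector_mul_bounded_linear)
  then obtain v0 where v0: "v0 \<in> sphere 0 1" "\<And>v. v \<in> sphere 0 1 \<Longrightarrow> ?q v0 \<le> ?q v"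
    using continuous_attains_inf[of "sphere 0 1" ?q]
    by (auto simp: compact_sphere sphere_eq_empty)
  show thesis
  proof (rule that[of "?q v0"])
    show "0 < ?q v0"
      using v0(1) assms by (cases "v0 = 0") (auto simp: positive_definite_def)
    fix v :: "real ^ 'm"
    show "?q v0 * (norm v)\<^sup>2 \<le> ?q v"
    proof (cases "v = 0")
      case False
      define w where "w = (1 / norm v) *\<^sub>R v"
      have v: "v = norm v *\<^sub>R w" and "w \<in> sphere 0 1"
        using False by (auto simp: w_def)
      have "?q v = (norm v)\<^sup>2 * ?q w"
        by (subst (1 2) v)
          (simp add: matrix_vector_mult_scaleR power2_eq_square)
      then show ?thesis
        using v0(2)[OF \<open>w \<in> sphere 0 1\<close>] by (simp add: mult.commute mult_right_mono)
    qed simp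
  qed
qed

text \<open>No nonzero vector can be in the kernel, since the quadratic form would vanish there.
  Transposing the left-inverse equation and using the symmetry of \<open>A\<close> makes the
  transposed inverse a right inverse, and the two inverses must agree.\<close>

lemma positive_definite_matrix_inv:
  fixes A :: "real ^ 'm ^ 'm::finite"
  assumes "positive_definite A"
  shows "matrix_inv A ** A = mat 1"
    and "transpose (matrix_inv A) = matrix_inv A"
proof -
  have "A *v v \<noteq> 0" if "v \<noteq> 0" for v
    using assms that by (fastforce simp: positive_definite_def)
  then have "invertible A"
    by (metis invertible_left_inverse matrix_left_invertible_ker)
  then show L: "matrix_inv A ** A = mat 1"
    unfolding invertible_def matrix_inv_def by (metis (mono_tags, lifting) someI_ex)
  have "A ** transpose (matrix_inv A) = mat 1"
    using L assms by (metis matrix_transpose_mul positive_definite_def transpose_mat)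
  then show "transpose (matrix_inv A) = matrix_inv A"
    by (metis L matrix_mul_assoc matrix_mul_lid matrix_mul_rid)
qed

text \<open>The kernel regression coefficients at \<open>x\<close>: the row vector that expresses
  \<Theta>(x, X) as a combination of the rows of the training kernel matrix when that matrix is
  invertible.\<close>

definition kernel_weights ::
  "('x \<Rightarrow> 'x \<Rightarrow> real) \<Rightarrow> ('m::finite \<Rightarrow> 'x) \<Rightarrow> 'x \<Rightarrow> real ^ 'm" where
  "kernel_weights \<Theta> X x = (\<chi> j. \<Theta> x (X j)) v* matrix_inv (kernel_matrix \<Theta> X X)"

text \<open>A Gronwall argument with the squared residual norm \<open>V\<close> as Lyapunov
  function: coercivity of the kernel matrix gives V' \<le> -2 \<beta> V, hence exponential
  decay.\<close>

lemma infinite_width_flow_residual_tendsto_0: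
  assumes flow: "infinite_width_flow \<Theta> X y f"
    and pd: "positive_definite (kernel_matrix \<Theta> X X)"
  shows "((\<lambda>t. f t (X j) - y j) \<longlongrightarrow> 0) at_top"
proof -
  define r where "r t = (\<chi> j. f t (X j) - y j)" for t
  define V where "V t = (\<Sum>j\<in>UNIV. (f t (X j) - y j)\<^sup>2)" for t
  obtain \<beta> where \<beta>: "0 < \<beta>" "\<And>v. \<beta> * (norm v)\<^sup>2 \<le> v \<bullet> (kernel_matrix \<Theta> X X *v v)"
    using positive_definite_coercive[OF pd] by blast
  have V_norm: "V t = (norm (r t))\<^sup>2" for t
    unfolding V_def r_def power2_norm_eq_inner by (simp add: inner_vec_def power2_eq_square)
  define D where "D t = - 2 * (r t \<bullet> (kernel_matrix \<Theta> X X *v r t))" for t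
  have D_le: "D t \<le> - 2 * \<beta> * V t" for t
    using \<beta>(2)[of "r t"] by (simp add: D_def V_norm)
  have dV: "(V has_real_derivative D t) (at t within {0..})" if "0 \<le> t" for t
  proof -
    note d = flow[unfolded infinite_width_flow_def, rule_format, OF that]
    show ?thesis
      unfolding V_def[abs_def]
      by (rule derivative_eq_intros d refl)+
        (simp add: D_def r_def inner_vec_def matrix_vector_mult_def kernel_matrix_def
          sum_distrib_left sum_negf mult_ac)
  qed
  \<comment> \<open>The integrating factor turns the differential inequality for \<open>V\<close>
    into monotonicity of \<open>E\<close>.\<close>
  define E where "E t = exp (2 * \<beta> * t) * V t" for t
  have dE: "(E has_real_derivative exp (2 * \<beta> * t) * (D t + 2 * \<beta> * V t)) (at t within {0..})"
    if "0 \<le> t" for t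
    unfolding E_def[abs_def]
    by (rule derivative_eq_intros dV[OF that] refl)+ (simp add: algebra_simps)
  have E_le: "E t \<le> E 0" if "0 \<le> t" for t
  proof (rule DERIV_nonpos_imp_decreasing_open[OF that])
    fix s assume s: "0 < s" "s < t"
    \<comment> \<open>The monotonicity rule asks for two-sided derivatives, which the flow supplies
      only at interior times; at time 0 continuity suffices.\<close>
    have "at s within {0..} = at s"
      using s by (intro at_within_interior) auto
    then have "DERIV E s :> exp (2 * \<beta> * s) * (D s + 2 * \<beta> * V s)"
      using dE[of s] s by simp
    moreover have "exp (2 * \<beta> * s) * (D s + 2 * \<beta> * V s) \<le> 0"
      using D_le[of s] by (intro mult_nonneg_nonpos) auto
    ultimately show "\<exists>y. DERIV E s :> y \<and> y \<le> 0"
      by blast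
  next
    have "continuous_on {0..} E"
      by (rule DERIV_continuous_on) (use dE in simp)
    then show "continuous_on {0..t} E"
      by (rule continuous_on_subset) auto
  qed
  have V_bound: "V t \<le> exp (- (2 * \<beta> * t)) * V 0" if "0 \<le> t" for t
  proof -
    have "V t = exp (- (2 * \<beta> * t)) * E t"
      by (simp add: E_def mult.assoc[symmetric] mult_exp_exp)
    also have "\<dots> \<le> exp (- (2 * \<beta> * t)) * V 0"
      using E_le[OF that] by (simp add: E_def)
    finally show ?thesis .
  qed
  have "filterlim (\<lambda>t. 2 * \<beta> * t) at_top at_top"
    using \<beta>(1) by (intro filterlim_tendsto_pos_mult_at_top[OF tendsto_const _ filterlim_ident]) simp
  then have "((\<lambda>t. exp (- (2 * \<beta> * t))) \<longlongrightarrow> 0) at_top"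
    by (intro filterlim_compose[OF exp_at_bot]) (simp only: filterlim_uminus_at_bot minus_minus)
  then have "((\<lambda>t. exp (- (2 * \<beta> * t)) * V 0) \<longlongrightarrow> 0) at_top"
    by (rule tendsto_mult_left_zero)
  moreover have "eventually (\<lambda>t. (f t (X j) - y j)\<^sup>2 \<le> exp (- (2 * \<beta> * t)) * V 0) at_top"
    using eventually_ge_at_top[of 0]
  proof eventually_elim
    case (elim t)
    have "(f t (X j) - y j)\<^sup>2 \<le> V t"
      unfolding V_def by (rule member_le_sum) auto
    then show ?case using V_bound[OF elim] by simp
  qed
  ultimately have "((\<lambda>t. (f t (X j) - y j)\<^sup>2) \<longlongrightarrow> 0) at_top"
    by - (rule tendsto_sandwich[OF _ _ tendsto_const], auto)
  then show ?thesis by simp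
qed

text \<open>The motion at any input \<open>x\<close> is driven by the training residuals alone.
  Subtracting their weighted sum from the prediction leaves a constant, and that sum vanishes in the
  limit, so the constant, read off at time 0, is the limit.\<close>

lemma infinite_width_flow_tendsto:
  assumes flow: "infinite_width_flow \<Theta> X y f"
    and pd: "positive_definite (kernel_matrix \<Theta> X X)"
  shows "((\<lambda>t. f t x) \<longlongrightarrow>
    f 0 x - (\<Sum>j\<in>UNIV. kernel_weights \<Theta> X x $ j * (f 0 (X j) - y j))) at_top"
proof -
  let ?w = "kernel_weights \<Theta> X x"
  \<comment> \<open>The weights solve \<open>w A = \<Theta>(x, X)\<close>, which makes the following quantity conserved.\<close>
  define c where "c t = f t x - (\<Sum>j\<in>UNIV. ?w $ j * (f t (X j) - y j))" for t
  have "?w v* kernel_matrix \<Theta> X X = (\<chi> j. \<Theta> x (X j))"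
    by (simp add: kernel_weights_def vector_matrix_mul_assoc positive_definite_matrix_inv[OF pd])
  then have w: "(\<Sum>j\<in>UNIV. ?w $ j * \<Theta> (X j) (X i)) = \<Theta> x (X i)" for i
    by (simp add: vec_eq_iff vector_matrix_mult_def kernel_matrix_def mult.commute)
  have "(c has_real_derivative 0) (at t within {0..})" if "0 \<le> t" for t
  proof -
    note d = flow[unfolded infinite_width_flow_def, rule_format, OF that]
    \<comment> \<open>Up to sign, the left side is the derivative of the weighted residuals and the
      right side that of \<open>f t x\<close>; their equality makes \<open>c\<close>
      stationary.\<close>
    have "(\<Sum>j\<in>UNIV. (\<Sum>i\<in>UNIV. (f t (X i) - y i) * \<Theta> (X j) (X i)) * ?w $ j)
        = (\<Sum>i\<in>UNIV. (f t (X i) - y i) * \<Theta> x (X i))"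
      unfolding w[symmetric] sum_distrib_left sum_distrib_right
      by (subst sum.swap) (simp add: mult_ac)
    then show ?thesis
      unfolding c_def[abs_def]
      by - ((rule derivative_eq_intros d refl)+, simp add: sum_negf mult.commute)
  qed
  then obtain k where k: "\<And>t. 0 \<le> t \<Longrightarrow> c t = k"
    using has_field_derivative_zero_constant[of "{0..}" c] by (auto simp: convex_real_interval)
  have "((\<lambda>t. k + (\<Sum>j\<in>UNIV. ?w $ j * (f t (X j) - y j))) \<longlongrightarrow> k + (\<Sum>j\<in>UNIV. ?w $ j * 0)) at_top"
    by (intro tendsto_intros infinite_width_flow_residual_tendsto_0[OF flow pd])
  moreover have "eventually (\<lambda>t. k + (\<Sum>j\<in>UNIV. ?w $ j * (f t (X j) - y j)) = f t x) at_top"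
    using eventually_ge_at_top[of 0]
  proof eventually_elim
    case (elim t)
    show ?case using k[OF elim] by (simp add: c_def)
  qed
  ultimately have "((\<lambda>t. f t x) \<longlongrightarrow> k) at_top"
    by (simp add: tendsto_cong)
  then show ?thesis
    using k[of 0] by (simp add: c_def)
qed

text \<open>\<open>converged\<close> is defined through \<open>Lim\<close>, which is informative
  only once a limit is known to exist; the preceding lemma provides it.\<close>

lemma infinite_width_flow_converged:
  assumes flow: "infinite_width_flow \<Theta> X y (\<lambda>t x. u t x \<omega>)"
    and pd: "positive_definite (kernel_matrix \<Theta> X X)"
  shows "converged u x \<omega> =
      u 0 x \<omega> - (\<Sum>j\<in>UNIV. kernel_weights \<Theta> X x $ j * (u 0 (X j) \<omega> - y j))"
    and "((\<lambda>t. u t x \<omega>) \<longlongrightarrow> converged u x \<omega>) at_top"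
proof -
  note lim = infinite_width_flow_tendsto[OF flow pd, of x]
  show eq: "converged u x \<omega> =
      u 0 x \<omega> - (\<Sum>j\<in>UNIV. kernel_weights \<Theta> X x $ j * (u 0 (X j) \<omega> - y j))"
    unfolding converged_def using lim by (intro tendsto_Lim) auto
  show "((\<lambda>t. u t x \<omega>) \<longlongrightarrow> converged u x \<omega>) at_top"
    using lim by (simp add: eq)
qed

subsection \<open>Symmetry of the tangent kernel\<close>

text \<open>With radius half the distance between the two candidates, no value lies within that
  radius of both. The two deviation events therefore cover a space of mass 1, so their probabilities
  cannot both tend to 0.\<close>

lemma tendsto_in_probability_unique:
  assumes prob: "\<And>n. prob_space (M n)"
    and c: "tendsto_in_probability M Z c" and d: "tendsto_in_probability M Z d"
  shows "c = d"
proof (rule ccontr)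
  assume "c \<noteq> d"
  define e where "e = \<bar>c - d\<bar> / 2"
  have "e > 0" using \<open>c \<noteq> d\<close> by (simp add: e_def)
  define P where "P b n = measure (M n) {\<omega> \<in> space (M n). e \<le> \<bar>Z n \<omega> - b\<bar>}" for b n
  have "P c \<longlonglongrightarrow> 0" "P d \<longlonglongrightarrow> 0"
    using c d \<open>e > 0\<close> by (auto simp: tendsto_in_probability_def P_def[abs_def])
  then have "(\<lambda>n. P c n + P d n) \<longlonglongrightarrow> 0"
    using tendsto_add[of "P c" 0 _ "P d" 0] by simp
  moreover have "1 \<le> P c n + P d n" for n
  proof -
    interpret prob_space "M n" by (rule prob)
    have [measurable]: "Z n \<in> borel_measurable (M n)"
      using c by (simp add: tendsto_in_probability_def)
    have "e \<le> \<bar>z - c\<bar> \<or> e \<le> \<bar>z - d\<bar>" for z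
      using abs_triangle_ineq4[of "z - d" "z - c"] by (auto simp: e_def)
    then have "space (M n) = {\<omega> \<in> space (M n). e \<le> \<bar>Z n \<omega> - c\<bar>} \<union> {\<omega> \<in> space (M n). e \<le> \<bar>Z n \<omega> - d\<bar>}"
      by auto
    then have "1 = prob ({\<omega> \<in> space (M n). e \<le> \<bar>Z n \<omega> - c\<bar>} \<union> {\<omega> \<in> space (M n). e \<le> \<bar>Z n \<omega> - d\<bar>})"
      using prob_space by simp
    also have "\<dots> \<le> P c n + P d n"
      unfolding P_def by (rule measure_Un_le) measurable
    finally show ?thesis .
  qed
  ultimately show False
    using LIMSEQ_le_const[of "\<lambda>n. P c n + P d n" 0 1] by auto
qed

lemma prob_space_init_law: "prob_space (init_law a n)"
  unfolding init_law_def by (intro prob_space_PiM prob_space_normal_density) simp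

text \<open>Every finite-width tangent kernel is symmetric, being an inner product of gradients.
  Positive definiteness gives symmetry on the training points only; the blocks that mix test and
  training points need this lemma.\<close>

lemma is_ntk_sym:
  assumes "is_ntk a \<Theta>"
  shows "\<Theta> x x' = \<Theta> x' x"
proof (rule tendsto_in_probability_unique[OF prob_space_init_law])
  show "tendsto_in_probability (init_law a) (\<lambda>n \<theta>. empirical_ntk a n \<theta> x x') (\<Theta> x x')"
    using assms by (simp add: is_ntk_def)
  show "tendsto_in_probability (init_law a) (\<lambda>n \<theta>. empirical_ntk a n \<theta> x x') (\<Theta> x' x)"
    using assms unfolding is_ntk_def empirical_ntk_def by (subst mult.commute) blast
qed

subsection \<open>Gaussian random variables, possibly degenerate\<close>

text \<open>Isolates what \<open>jointly_gaussian\<close> demands of each linear combination, so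
  that closure properties can be proved one random variable at a time.\<close>

definition gaussian_rv :: "'w measure \<Rightarrow> ('w \<Rightarrow> real) \<Rightarrow> bool" where
  "gaussian_rv M Z \<longleftrightarrow> Z \<in> borel_measurable M \<and>
     (\<exists>\<mu> \<sigma>. 0 \<le> \<sigma> \<and> distr M borel Z = normal_law \<mu> \<sigma>)"

context prob_space
begin

lemma distr_eq_normal_density_iff:
  assumes "Z \<in> borel_measurable M"
  shows "distr M borel Z = density lborel (normal_density \<mu> \<sigma>) \<longleftrightarrow>
    distributed M lborel Z (normal_density \<mu> \<sigma>)"
proof -
  have "distr M borel Z = distr M lborel Z" by (intro distr_cong) auto
  then show ?thesis using assms by (simp add: distributed_def)
qed

text \<open>Separates the point masses from the laws with a density, for which facts about
  \<open>normal_density\<close> are available.\<close>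

lemma gaussian_rv_iff:
  "gaussian_rv M Z \<longleftrightarrow> Z \<in> borel_measurable M \<and>
     ((\<exists>\<mu>. AE \<omega> in M. Z \<omega> = \<mu>) \<or>
      (\<exists>\<mu> \<sigma>. 0 < \<sigma> \<and> distributed M lborel Z (normal_density \<mu> \<sigma>)))"
proof (cases "Z \<in> borel_measurable M")
  case meas [measurable]: True
  have const: "distr M borel Z = return borel \<mu> \<longleftrightarrow> (AE \<omega> in M. Z \<omega> = \<mu>)" for \<mu>
  proof
    assume eq: "distr M borel Z = return borel \<mu>"
    have "AE x in return borel \<mu>. x = \<mu>" by (subst AE_return) auto
    then show "AE \<omega> in M. Z \<omega> = \<mu>"
      by (subst (asm) eq[symmetric], subst (asm) AE_distr_iff) auto
  next
    assume "AE \<omega> in M. Z \<omega> = \<mu>"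
    then have "distr M borel Z = distr M borel (\<lambda>_. \<mu>)"
      by (intro distr_cong_AE) auto
    also have "\<dots> = return borel \<mu>" by (intro distr_const) auto
    finally show "distr M borel Z = return borel \<mu>" .
  qed
  show ?thesis
    unfolding gaussian_rv_def normal_law_def
    using distr_eq_normal_density_iff[OF meas] const
    by (metis order_le_less order_less_irrefl)
qed (simp add: gaussian_rv_def)

lemma gaussian_rv_cong:
  assumes "gaussian_rv M Y" "\<And>\<omega>. \<omega> \<in> space M \<Longrightarrow> Z \<omega> = Y \<omega>"
  shows "gaussian_rv M Z"
proof -
  have "Z \<in> borel_measurable M \<longleftrightarrow> Y \<in> borel_measurable M"
    using assms(2) by (intro measurable_cong)
  moreover have "distr M borel Z = distr M borel Y"
    using assms(2) by (intro distr_cong) auto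
  ultimately show ?thesis using assms(1) by (simp add: gaussian_rv_def)
qed

lemma gaussian_rv_add_AE_const:
  assumes Y: "gaussian_rv M Y" and [measurable]: "Z \<in> borel_measurable M"
    and Z: "AE \<omega> in M. Z \<omega> = \<mu>"
  shows "gaussian_rv M (\<lambda>\<omega>. Z \<omega> + Y \<omega>)"
proof -
  have [measurable]: "Y \<in> borel_measurable M" using Y by (simp add: gaussian_rv_def)
  show ?thesis
  proof (cases "\<exists>\<nu>. AE \<omega> in M. Y \<omega> = \<nu>")
    case True
    then obtain \<nu> where "AE \<omega> in M. Y \<omega> = \<nu>" by blast
    with Z have "AE \<omega> in M. Z \<omega> + Y \<omega> = \<mu> + \<nu>" by eventually_elim simp
    then show ?thesis by (auto simp: gaussian_rv_iff)
  next
    case False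
    then obtain \<nu> \<tau> where \<tau>: "0 < \<tau>" "distributed M lborel Y (normal_density \<nu> \<tau>)"
      using Y unfolding gaussian_rv_iff by blast
    \<comment> \<open>The translate is written with slope 1 to match
      \<open>normal_density_affine\<close>.\<close>
    have "distr M borel (\<lambda>\<omega>. Z \<omega> + Y \<omega>) = distr M borel (\<lambda>\<omega>. \<mu> + 1 * Y \<omega>)"
      using Z by (intro distr_cong_AE) auto
    also have "\<dots> = density lborel (normal_density (\<mu> + 1 * \<nu>) (\<bar>1\<bar> * \<tau>))"
      by (subst distr_eq_normal_density_iff) (use normal_density_affine[OF \<tau>(2,1), of 1 \<mu>] in auto)
    finally have "distributed M lborel (\<lambda>\<omega>. Z \<omega> + Y \<omega>) (normal_density (\<mu> + 1 * \<nu>) (\<bar>1\<bar> * \<tau>))"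
      by (subst (asm) distr_eq_normal_density_iff) auto
    then show ?thesis
      unfolding gaussian_rv_iff using \<tau>(1) by auto
  qed
qed

text \<open>\<open>add_indep_normal\<close> asks for strictly positive deviations on both sides, so
  an almost surely constant summand is treated separately as a translation.\<close>

lemma gaussian_rv_add_indep:
  assumes Y: "gaussian_rv M Y" and Z: "gaussian_rv M Z" and indep: "indep_var borel Y borel Z"
  shows "gaussian_rv M (\<lambda>\<omega>. Y \<omega> + Z \<omega>)"
proof -
  have [measurable]: "Y \<in> borel_measurable M" "Z \<in> borel_measurable M"
    using Y Z by (simp_all add: gaussian_rv_def)
  consider \<mu> where "AE \<omega> in M. Y \<omega> = \<mu>" | \<mu> where "AE \<omega> in M. Z \<omega> = \<mu>"
    | \<mu> \<sigma> \<nu> \<tau> where "0 < \<sigma>" "distributed M lborel Y (normal_density \<mu> \<sigma>)"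
      "0 < \<tau>" "distributed M lborel Z (normal_density \<nu> \<tau>)"
    using Y Z unfolding gaussian_rv_iff by blast
  then show ?thesis
  proof cases
    case 1
    then show ?thesis using Z by (intro gaussian_rv_add_AE_const) auto
  next
    case 2
    then have "gaussian_rv M (\<lambda>\<omega>. Z \<omega> + Y \<omega>)" using Y by (intro gaussian_rv_add_AE_const) auto
    then show ?thesis by (simp add: add.commute)
  next
    case 3
    have "0 < sqrt (\<sigma>\<^sup>2 + \<tau>\<^sup>2)" using 3 by (simp add: add_pos_pos)
    then show ?thesis
      using add_indep_normal[OF indep 3(1,3,2,4)] unfolding gaussian_rv_iff by auto
  qed
qed

lemma gaussian_rv_square_integrable:
  assumes "gaussian_rv M Z"
  shows "integrable M (\<lambda>\<omega>. (Z \<omega>)\<^sup>2)"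
proof -
  have [measurable]: "Z \<in> borel_measurable M" using assms by (simp add: gaussian_rv_def)
  consider \<mu> where "AE \<omega> in M. Z \<omega> = \<mu>"
    | \<mu> \<sigma> where "0 < \<sigma>" "distributed M lborel Z (normal_density \<mu> \<sigma>)"
    using assms unfolding gaussian_rv_iff by blast
  then show ?thesis
  proof cases
    case 1
    then have "AE \<omega> in M. (Z \<omega>)\<^sup>2 = \<mu>\<^sup>2" by eventually_elim simp
    then show ?thesis by (subst integrable_cong_AE[where g = "\<lambda>_. \<mu>\<^sup>2"]) auto
  next
    case 2
    note moments = integrable_normal_moment[OF 2(1), of \<mu> 2] integrable_normal_moment_nz_1[OF 2(1), of \<mu>]
      integrable_normal_density[OF 2(1), of \<mu>]
    \<comment> \<open>The second moment is assembled from the central one by x^2 = (x - \<mu>)^2 + 2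
      \<mu> x - \<mu>^2.\<close>
    have "integrable lborel (\<lambda>x. normal_density \<mu> \<sigma> x * (x - \<mu>)\<^sup>2
        + 2 * \<mu> * (normal_density \<mu> \<sigma> x * x) - \<mu>\<^sup>2 * normal_density \<mu> \<sigma> x)"
      using moments by (intro Bochner_Integration.integrable_add Bochner_Integration.integrable_diff
          integrable_mult_right) auto
    then have "integrable lborel (\<lambda>x. normal_density \<mu> \<sigma> x * x\<^sup>2)"
      by (simp add: power2_eq_square algebra_simps)
    then show ?thesis
      by (subst (asm) distributed_integrable[OF 2(2)]) auto
  qed
qed

lemma integrable_mult_of_squares:
  fixes Y Z :: "'a \<Rightarrow> real"
  assumes [measurable]: "Y \<in> borel_measurable M" "Z \<in> borel_measurable M"
    and "integrable M (\<lambda>\<omega>. (Y \<omega>)\<^sup>2)" "integrable M (\<lambda>\<omega>. (Z \<omega>)\<^sup>2)"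
  shows "integrable M (\<lambda>\<omega>. Y \<omega> * Z \<omega>)"
proof (rule Bochner_Integration.integrable_bound)
  show "integrable M (\<lambda>\<omega>. (Y \<omega>)\<^sup>2 + (Z \<omega>)\<^sup>2)"
    using assms by simp
  have "\<bar>a * b\<bar> \<le> a\<^sup>2 + b\<^sup>2" for a b :: real
  proof -
    have "2 * (\<bar>a\<bar> * \<bar>b\<bar>) \<le> \<bar>a\<bar>\<^sup>2 + \<bar>b\<bar>\<^sup>2"
      using sum_squares_bound[of "\<bar>a\<bar>" "\<bar>b\<bar>"] by (simp add: mult.assoc)
    moreover have "0 \<le> \<bar>a\<bar> * \<bar>b\<bar>" by simp
    ultimately show ?thesis unfolding abs_mult power2_abs by linarith
  qed
  then show "AE \<omega> in M. norm (Y \<omega> * Z \<omega>) \<le> norm ((Y \<omega>)\<^sup>2 + (Z \<omega>)\<^sup>2)"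
    by (intro AE_I2) simp
qed simp

subsection \<open>Linear images of Gaussian processes\<close>

text \<open>The family \<open>p\<close> may repeat points, whereas \<open>jointly_gaussian\<close>
  on a set of points gives each point a single coefficient; coefficients are therefore summed over
  the fibres of \<open>p\<close>.\<close>

lemma gaussian_rv_lincomb:
  fixes p :: "'j \<Rightarrow> 'x"
  assumes U: "centered_gp M U \<kappa>" and J: "finite J"
  shows "gaussian_rv M (\<lambda>\<omega>. \<Sum>j\<in>J. w j * U (p j) \<omega>)"
proof -
  define c where "c a = (\<Sum>j | j \<in> J \<and> p j = a. w j)" for a
  have eq: "(\<Sum>j\<in>J. w j * U (p j) \<omega>) = (\<Sum>a\<in>p ` J. c a * U a \<omega>)" for \<omega>
    by (subst sum.image_gen[OF J, of _ p]) (auto simp: c_def sum_distrib_right intro!: sum.cong)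
  have "jointly_gaussian M (p ` J) U"
    using U J by (simp add: centered_gp_def)
  then show ?thesis
    unfolding eq gaussian_rv_def jointly_gaussian_def
    by (auto intro!: borel_measurable_sum borel_measurable_times)
qed

text \<open>The mean and covariance equations in \<open>centered_gp\<close> do not by themselves
  give integrability, because a Bochner integral defaults to 0. Integrability comes from the finite
  second moments of Gaussian variables.\<close>

lemma centered_gpD:
  assumes U: "centered_gp M U \<kappa>"
  shows "U x \<in> borel_measurable M" and "gaussian_rv M (U x)"
    and "integrable M (\<lambda>\<omega>. U x \<omega> * U y \<omega>)" and "integrable M (U x)"
    and "(\<integral>\<omega>. U x \<omega> \<partial>M) = 0" and "(\<integral>\<omega>. U x \<omega> * U y \<omega> \<partial>M) = \<kappa> x y"
proof -
  have gauss: "gaussian_rv M (U x)" for x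
    using gaussian_rv_lincomb[OF U, of "{x}" "\<lambda>_. 1" "\<lambda>x. x"] by simp
  show "gaussian_rv M (U x)" by (rule gauss)
  have [measurable]: "U x \<in> borel_measurable M" for x
    using gauss by (simp add: gaussian_rv_def)
  show "U x \<in> borel_measurable M" by measurable
  show "integrable M (\<lambda>\<omega>. U x \<omega> * U y \<omega>)"
    by (intro integrable_mult_of_squares gaussian_rv_square_integrable gauss) auto
  have "integrable M (\<lambda>\<omega>. U x \<omega> * 1)"
    using gaussian_rv_square_integrable[OF gauss] by (intro integrable_mult_of_squares) auto
  then show "integrable M (U x)" by simp
  have zero: "(\<integral>\<omega>. U x \<omega> \<partial>M) = 0" for x
    using U by (simp add: centered_gp_def)
  show "(\<integral>\<omega>. U x \<omega> \<partial>M) = 0" by (rule zero)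
  show "(\<integral>\<omega>. U x \<omega> * U y \<omega> \<partial>M) = \<kappa> x y"
    using U by (simp add: centered_gp_def covariance_def zero)
qed

lemma centered_gpI:
  assumes "\<And>A c. finite A \<Longrightarrow> gaussian_rv M (\<lambda>\<omega>. \<Sum>a\<in>A. c a * U a \<omega>)"
    and "\<And>x. (\<integral>\<omega>. U x \<omega> \<partial>M) = 0"
    and "\<And>x y. (\<integral>\<omega>. U x \<omega> * U y \<omega> \<partial>M) = \<kappa> x y"
  shows "centered_gp M U \<kappa>"
proof -
  have "U x \<in> borel_measurable M" for x
    using assms(1)[of "{x}" "\<lambda>_. 1"] by (simp add: gaussian_rv_def)
  then show ?thesis
    using assms by (auto simp: centered_gp_def jointly_gaussian_def covariance_def gaussian_rv_def)
qed

text \<open>Both sums are measurable functions on the product space of paths, and independence is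
  preserved under such functions.\<close>

lemma independent_processes_lincomb:
  assumes "independent_processes M U V"
  shows "indep_var borel (\<lambda>\<omega>. \<Sum>a\<in>A. c a * U a \<omega>) borel (\<lambda>\<omega>. \<Sum>b\<in>A'. d b * V b \<omega>)"
  using indep_var_compose[OF assms[unfolded independent_processes_def],
      of "\<lambda>f. \<Sum>a\<in>A. c a * f a" borel "\<lambda>f. \<Sum>b\<in>A'. d b * f b" borel]
  by (auto simp: o_def)

text \<open>Independence and zero means remove the cross terms, so the kernels add despite the minus
  sign. Gaussianity follows by adding independent Gaussian combinations.\<close>

lemma centered_gp_diff_indep:
  assumes U: "centered_gp M U \<kappa>" and V: "centered_gp M V \<kappa>'"
    and indep: "independent_processes M U V"
  shows "centered_gp M (\<lambda>x \<omega>. U x \<omega> - V x \<omega>) (error_kernel \<kappa> \<kappa>')"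
proof (rule centered_gpI)
  note int = centered_gpD(3,4)[OF U] centered_gpD(3,4)[OF V]
  fix x y
  have UV: "integrable M (\<lambda>\<omega>. U x \<omega> * V y \<omega>)" "(\<integral>\<omega>. U x \<omega> * V y \<omega> \<partial>M) = 0" for x y
  proof -
    have "indep_var borel (U x) borel (V y)"
      using independent_processes_lincomb[OF indep, of "\<lambda>_. 1" "{x}" "\<lambda>_. 1" "{y}"] by simp
    then show "integrable M (\<lambda>\<omega>. U x \<omega> * V y \<omega>)" "(\<integral>\<omega>. U x \<omega> * V y \<omega> \<partial>M) = 0"
      using indep_var_integrable[of "U x" "V y"] indep_var_lebesgue_integral[of "U x" "V y"]
        int centered_gpD(5)[OF U] by simp_all
  qed
  show "(\<integral>\<omega>. U x \<omega> - V x \<omega> \<partial>M) = 0"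
    using int centered_gpD(5)[OF U] centered_gpD(5)[OF V] by simp
  have "(\<integral>\<omega>. (U x \<omega> - V x \<omega>) * (U y \<omega> - V y \<omega>) \<partial>M)
      = (\<integral>\<omega>. U x \<omega> * U y \<omega> + V x \<omega> * V y \<omega> - (U x \<omega> * V y \<omega> + U y \<omega> * V x \<omega>) \<partial>M)"
    by (intro Bochner_Integration.integral_cong) (auto simp: algebra_simps)
  also have "\<dots> = error_kernel \<kappa> \<kappa>' x y"
    using int UV centered_gpD(6)[OF U] centered_gpD(6)[OF V] by (simp add: error_kernel_def)
  finally show "(\<integral>\<omega>. (U x \<omega> - V x \<omega>) * (U y \<omega> - V y \<omega>) \<partial>M) = error_kernel \<kappa> \<kappa>' x y" .
next
  fix A :: "'b set" and c :: "'b \<Rightarrow> real"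
  assume A: "finite A"
  \<comment> \<open>The sign is moved into the coefficients, so that the result on sums
    applies.\<close>
  have "indep_var borel (\<lambda>\<omega>. \<Sum>a\<in>A. c a * U a \<omega>) borel (\<lambda>\<omega>. \<Sum>a\<in>A. - c a * V a \<omega>)"
    by (rule independent_processes_lincomb[OF indep])
  then have "gaussian_rv M (\<lambda>\<omega>. (\<Sum>a\<in>A. c a * U a \<omega>) + (\<Sum>a\<in>A. - c a * V a \<omega>))"
    using gaussian_rv_lincomb[OF U A, of c "\<lambda>x. x"] gaussian_rv_lincomb[OF V A, of "\<lambda>a. - c a" "\<lambda>x. x"]
    by (intro gaussian_rv_add_indep) auto
  then show "gaussian_rv M (\<lambda>\<omega>. \<Sum>a\<in>A. c a * (U a \<omega> - V a \<omega>))"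
    by (simp add: algebra_simps sum_subtractf sum_negf)
qed

text \<open>Each value of \<open>E\<close> is a finite linear combination of values of
  \<open>D\<close>, so Gaussianity is inherited, and the kernel comes from expanding the product of
  two such combinations.\<close>

lemma centered_gp_interpolation_error:
  fixes X :: "'m::finite \<Rightarrow> 'x"
  assumes D: "centered_gp M D \<kappa>"
    and E: "\<And>x \<omega>. \<omega> \<in> space M \<Longrightarrow> E x \<omega> = D x \<omega> - (\<Sum>j\<in>UNIV. w x j * D (X j) \<omega>)"
  shows "centered_gp M E (\<lambda>x y. \<kappa> x y
      + (\<Sum>i\<in>UNIV. \<Sum>j\<in>UNIV. w x i * w y j * \<kappa> (X i) (X j))
      - ((\<Sum>i\<in>UNIV. w x i * \<kappa> (X i) y) + (\<Sum>j\<in>UNIV. w y j * \<kappa> x (X j))))"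
proof (rule centered_gpI)
  note int = centered_gpD(3,4)[OF D]
  note vals = centered_gpD(5,6)[OF D]
  fix x y
  have "(\<integral>\<omega>. E x \<omega> \<partial>M) = (\<integral>\<omega>. D x \<omega> - (\<Sum>j\<in>UNIV. w x j * D (X j) \<omega>) \<partial>M)"
    using E by (intro Bochner_Integration.integral_cong) auto
  also have "\<dots> = 0"
    using int vals by (subst Bochner_Integration.integral_diff) auto
  finally show "(\<integral>\<omega>. E x \<omega> \<partial>M) = 0" .
  have "(\<integral>\<omega>. E x \<omega> * E y \<omega> \<partial>M) = (\<integral>\<omega>. D x \<omega> * D y \<omega>
      + (\<Sum>i\<in>UNIV. \<Sum>j\<in>UNIV. w x i * w y j * (D (X i) \<omega> * D (X j) \<omega>))
      - ((\<Sum>i\<in>UNIV. w x i * (D (X i) \<omega> * D y \<omega>)) + (\<Sum>j\<in>UNIV. w y j * (D x \<omega> * D (X j) \<omega>))) \<partial>M)"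
  proof (intro Bochner_Integration.integral_cong refl)
    fix \<omega> assume "\<omega> \<in> space M"
    have dist: "(a - s) * (b - t) = a * b + s * t - (s * b + t * a)" for a b s t :: real
      by (simp add: algebra_simps)
    show "E x \<omega> * E y \<omega> = D x \<omega> * D y \<omega>
      + (\<Sum>i\<in>UNIV. \<Sum>j\<in>UNIV. w x i * w y j * (D (X i) \<omega> * D (X j) \<omega>))
      - ((\<Sum>i\<in>UNIV. w x i * (D (X i) \<omega> * D y \<omega>)) + (\<Sum>j\<in>UNIV. w y j * (D x \<omega> * D (X j) \<omega>)))"
      unfolding E[OF \<open>\<omega> \<in> space M\<close>] dist sum_product
      by (simp add: sum_distrib_left sum_distrib_right mult_ac)
  qed
  also have "\<dots> = \<kappa> x y + (\<Sum>i\<in>UNIV. \<Sum>j\<in>UNIV. w x i * w y j * \<kappa> (X i) (X j))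
      - ((\<Sum>i\<in>UNIV. w x i * \<kappa> (X i) y) + (\<Sum>j\<in>UNIV. w y j * \<kappa> x (X j)))"
    using int vals by simp
  finally show "(\<integral>\<omega>. E x \<omega> * E y \<omega> \<partial>M) = \<kappa> x y
      + (\<Sum>i\<in>UNIV. \<Sum>j\<in>UNIV. w x i * w y j * \<kappa> (X i) (X j))
      - ((\<Sum>i\<in>UNIV. w x i * \<kappa> (X i) y) + (\<Sum>j\<in>UNIV. w y j * \<kappa> x (X j)))" .
next
  fix A :: "'x set" and c :: "'x \<Rightarrow> real"
  assume A: "finite A"
  \<comment> \<open>Indexing by a disjoint sum keeps points of \<open>A\<close> apart from training
    indices even where the inputs coincide. The right summand collects the total weight that lands
    on each training index.\<close>
  define v where "v = case_sum c (\<lambda>j. - (\<Sum>x\<in>A. c x * w x j))"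
  have "gaussian_rv M (\<lambda>\<omega>. \<Sum>j\<in>A <+> UNIV. v j * D (case_sum (\<lambda>x. x) X j) \<omega>)"
    using A by (intro gaussian_rv_lincomb[OF D]) auto
  then show "gaussian_rv M (\<lambda>\<omega>. \<Sum>a\<in>A. c a * E a \<omega>)"
  proof (rule gaussian_rv_cong)
    fix \<omega> assume "\<omega> \<in> space M"
    have "(\<Sum>x\<in>A. c x * (\<Sum>j\<in>UNIV. w x j * D (X j) \<omega>))
        = (\<Sum>j\<in>UNIV. (\<Sum>x\<in>A. c x * w x j) * D (X j) \<omega>)"
      unfolding sum_distrib_left sum_distrib_right by (subst sum.swap) (simp add: mult.assoc)
    then show "(\<Sum>a\<in>A. c a * E a \<omega>) = (\<Sum>j\<in>A <+> UNIV. v j * D (case_sum (\<lambda>x. x) X j) \<omega>)"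
      using A by (simp add: E[OF \<open>\<omega> \<in> space M\<close>] sum.Plus v_def right_diff_distrib
          sum_subtractf sum_negf)
  qed
qed

end

text \<open>The convergence conjunct makes the claims about the error meaningful, as
  \<open>converged\<close> is a \<open>Lim\<close>. The proof translates the weighted sums of the
  preceding lemmas into matrix products.\<close>

theorem theorem3p1:
  fixes M :: "'w measure"
    and arch_u arch_g :: architecture
    and \<kappa>u \<kappa>g \<Theta> :: "real ^ 'd::finite \<Rightarrow> real ^ 'd \<Rightarrow> real"
    and u :: "real \<Rightarrow> real ^ 'd \<Rightarrow> 'w \<Rightarrow> real"
    and g :: "real ^ 'd \<Rightarrow> 'w \<Rightarrow> real"
    and X :: "'m::finite \<Rightarrow> real ^ 'd"
    and XT :: "'k::finite \<Rightarrow> real ^ 'd"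
  assumes "prob_space M"
    and "valid_architecture arch_u" and "valid_architecture arch_g"
    and "infinite_width_init arch_u M \<kappa>u (u 0)"
    and "infinite_width_init arch_g M \<kappa>g g"
    and "independent_processes M (u 0) g"
    and "is_ntk arch_u \<Theta>"
    and "positive_definite (kernel_matrix \<Theta> X X)"
    and "\<forall>\<omega>\<in>space M. infinite_width_flow \<Theta> X (\<lambda>j. g (X j) \<omega>) (\<lambda>t x. u t x \<omega>)"
  shows "(\<forall>\<omega>\<in>space M. \<forall>x. ((\<lambda>t. u t x \<omega>) \<longlongrightarrow> converged u x \<omega>) at_top) \<and>
    (\<forall>x x'. covariance M (\<lambda>\<omega>. u 0 x \<omega> - g x \<omega>) (\<lambda>\<omega>. u 0 x' \<omega> - g x' \<omega>)
       = error_kernel \<kappa>u \<kappa>g x x') \<and>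
    jointly_gaussian M UNIV (\<lambda>i. post_convergence_error u g (XT i)) \<and>
    (\<forall>i. (\<integral>\<omega>. post_convergence_error u g (XT i) \<omega> \<partial>M) = 0) \<and>
    covariance_matrix M (\<lambda>i. post_convergence_error u g (XT i)) =
      (let \<Theta>inv = matrix_inv (kernel_matrix \<Theta> X X);
           \<kappa>e = error_kernel \<kappa>u \<kappa>g;
           C = kernel_matrix \<Theta> XT X ** \<Theta>inv ** kernel_matrix \<kappa>e X XT
       in kernel_matrix \<kappa>e XT XT
          + kernel_matrix \<Theta> XT X ** \<Theta>inv ** kernel_matrix \<kappa>e X X ** \<Theta>inv ** kernel_matrix \<Theta> X XT
          - (C + transpose C))"
proof -
  interpret prob_space M by fact
  note pd = \<open>positive_definite (kernel_matrix \<Theta> X X)\<close>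
  note flow = \<open>\<forall>\<omega>\<in>space M. infinite_width_flow \<Theta> X (\<lambda>j. g (X j) \<omega>) (\<lambda>t x. u t x \<omega>)\<close>
  define \<kappa>e where "\<kappa>e = error_kernel \<kappa>u \<kappa>g"
  define \<Theta>inv where "\<Theta>inv = matrix_inv (kernel_matrix \<Theta> X X)"
  define K where "K = kernel_matrix \<Theta> XT X ** \<Theta>inv"
  define w where "w x j = kernel_weights \<Theta> X x $ j" for x j
  have D: "centered_gp M (\<lambda>x \<omega>. u 0 x \<omega> - g x \<omega>) \<kappa>e"
    unfolding \<kappa>e_def using assms(4-6)
    by (intro centered_gp_diff_indep) (auto simp: infinite_width_init_def)
  have eps: "post_convergence_error u g x \<omega> =
      (u 0 x \<omega> - g x \<omega>) - (\<Sum>j\<in>UNIV. w x j * (u 0 (X j) \<omega> - g (X j) \<omega>))" if "\<omega> \<in> space M" for x \<omega>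
    using infinite_width_flow_converged(1)[where u = u and \<omega> = \<omega>, OF flow[rule_format, OF that] pd]
    by (simp add: post_convergence_error_def w_def)
  note E = centered_gp_interpolation_error[OF D eps]
  \<comment> \<open>Symmetry is inherited from the covariance that \<open>\<kappa>e\<close>
    represents; it will turn the second cross term into the transpose of the first.\<close>
  have \<kappa>e_sym: "\<kappa>e x y = \<kappa>e y x" for x y
    using centered_gpD(6)[OF D] by (metis (no_types, lifting) Bochner_Integration.integral_cong mult.commute)
  \<comment> \<open>The rows of \<open>K\<close> are the regression weights at the test
    points.\<close>
  have wK: "w (XT i) j = K $ i $ j" for i j
    by (simp add: w_def K_def kernel_weights_def \<Theta>inv_def vector_matrix_mult_def
        matrix_matrix_mult_def kernel_matrix_def mult.commute)
  have "transpose (kernel_matrix \<Theta> XT X) = kernel_matrix \<Theta> X XT"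
    using is_ntk_sym[OF \<open>is_ntk arch_u \<Theta>\<close>] by (simp add: vec_eq_iff transpose_def kernel_matrix_def)
  \<comment> \<open>Transposition reverses the product, and both the inverse and the tangent kernel
    are symmetric.\<close>
  then have KT: "\<Theta>inv ** kernel_matrix \<Theta> X XT = transpose K"
    by (simp add: K_def matrix_transpose_mul \<Theta>inv_def positive_definite_matrix_inv(2)[OF pd])
  have "jointly_gaussian M UNIV (\<lambda>i. post_convergence_error u g (XT i))"
    using gaussian_rv_lincomb[OF E, of UNIV _ XT] centered_gpD(1)[OF E]
    by (auto simp: jointly_gaussian_def gaussian_rv_def)
  moreover have "covariance_matrix M (\<lambda>i. post_convergence_error u g (XT i)) =
      kernel_matrix \<kappa>e XT XT + K ** kernel_matrix \<kappa>e X X ** transpose K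
      - (K ** kernel_matrix \<kappa>e X XT + transpose (K ** kernel_matrix \<kappa>e X XT))"
  proof -
    have "(K ** kernel_matrix \<kappa>e X X ** transpose K) $ i $ j =
        (\<Sum>a\<in>UNIV. \<Sum>b\<in>UNIV. K $ i $ a * K $ j $ b * \<kappa>e (X a) (X b))" for i j
      by (simp add: matrix_matrix_mult_def transpose_def kernel_matrix_def sum_distrib_right)
        (subst sum.swap, simp add: mult_ac)
    then show ?thesis
      using E unfolding centered_gp_def covariance_matrix_def
      by (simp add: vec_eq_iff wK)
        (simp add: matrix_matrix_mult_def transpose_def kernel_matrix_def \<kappa>e_sym)
  qed
  moreover have "kernel_matrix \<Theta> XT X ** \<Theta>inv ** kernel_matrix \<kappa>e X X ** \<Theta>inv ** kernel_matrix \<Theta> X XT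
      = K ** kernel_matrix \<kappa>e X X ** transpose K"
    unfolding KT[symmetric] by (simp add: K_def matrix_mul_assoc)
  ultimately show ?thesis
    using infinite_width_flow_converged(2)[where u = u, OF flow[rule_format] pd] D centered_gpD(5)[OF E]
    unfolding Let_def \<Theta>inv_def[symmetric] \<kappa>e_def[symmetric] K_def[symmetric]
    by (auto simp: centered_gp_def)
qed

end
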